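(* For every integer $q\ge2$, \[ \sum_{n=1}^\infty\frac{\binom{2n}{n}}{4^nn^{q-1}}=(-1)^q\sum_{\substack{k_1+k_2+k_3+k_4=q-1\\k_1,\dots,k_4\ge0}}G(k_1,k_2,k_3,k_4). \]
   Context: Let $\zeta$ be the Riemann zeta function. The exponential complete Bell polynomials $Y_n$ are defined by $\exp\big(\sum_{k\ge1}x_k\frac{t^k}{k!}\big)=\sum_{n\ge0}Y_n(x_1,\dots,x_n)\frac{t^n}{n!}$. Set $C_n=Y_n(0,1!\zeta(2),-2!\zeta(3),\dots,(-1)^n(n-1)!\zeta(n))$ and $D_n=Y_n(0,-1!\zeta(2),2!\zeta(3),\dots,(-1)^{n-1}(n-1)!\zeta(n))$. Define $G(k_1,k_2,k_3,k_4)=\frac{2^{k_3+k_4}\log^{k_4}(2)\,C_{k_1}C_{k_2}D_{k_3}}{k_1!\,k_2!\,k_3!\,k_4!}$. *)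

theory Defs
  imports "HOL-Analysis.Analysis" "HOL-Computational_Algebra.Formal_Power_Series"
begin

(* The Riemann zeta function on the real half-line s > 1, where it is given by its
   Dirichlet series.  For s <= 1 the value is meaningless and is never used below. *)
definition zeta :: "real \<Rightarrow> real" where
  "zeta s = (\<Sum>n. 1 / real (Suc n) powr s)"

(* Exponential complete Bell polynomials: the arguments are given as a sequence x,
   of which bell_Y n x uses only the entries x 1, ..., x n (see bell_Y_cong).  The constant
   term of the inner series is 0, so x 0 is ignored and the composition is the
   genuine substitution into exp. *)
definition bell_Y :: "nat \<Rightarrow> (nat \<Rightarrow> 'a::field_char_0) \<Rightarrow> 'a" where
  "bell_Y n x =
     fact n * fps_nth (fps_exp 1 oo Abs_fps (\<lambda>k. if k = 0 then 0 else x k / fact k)) n"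

lemma bell_Y_generating_function:
  "fps_exp 1 oo Abs_fps (\<lambda>k. if k = 0 then 0 else x k / fact k)
     = Abs_fps (\<lambda>n. bell_Y n x / (fact n :: 'a::field_char_0))"
  by (rule fps_ext) (simp add: bell_Y_def)

lemma bell_Y_cong:
  assumes "\<And>k. 1 \<le> k \<Longrightarrow> k \<le> n \<Longrightarrow> x k = y k"
  shows "bell_Y n x = bell_Y n (y :: nat \<Rightarrow> 'a::field_char_0)"
proof -
  define f g where "f = Abs_fps (\<lambda>k. if k = 0 then 0 else x k / fact k)"
    and "g = Abs_fps (\<lambda>k. if k = 0 then 0 else y k / fact k)"
  have fg: "fps_nth f k = fps_nth g k" if "k \<le> n" for k
    using assms that by (simp add: f_def g_def)
  have "fps_nth (f ^ i) k = fps_nth (g ^ i) k" if "k \<le> n" for i k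
    using that
  proof (induction i arbitrary: k)
    case (Suc i)
    then show ?case by (auto simp: fps_mult_nth fg intro!: sum.cong)
  qed simp
  then show ?thesis
    unfolding bell_Y_def f_def[symmetric] g_def[symmetric] by (simp add: fps_compose_nth)
qed

definition C :: "nat \<Rightarrow> real" where
  "C n = bell_Y n (\<lambda>k. if k = 1 then 0 else (-1) ^ k * fact (k - 1) * zeta (real k))"

definition D :: "nat \<Rightarrow> real" where
  "D n = bell_Y n (\<lambda>k. if k = 1 then 0 else (-1) ^ (k - 1) * fact (k - 1) * zeta (real k))"

definition G :: "nat \<Rightarrow> nat \<Rightarrow> nat \<Rightarrow> nat \<Rightarrow> real" where
  "G k1 k2 k3 k4 =
     2 ^ (k3 + k4) * ln 2 ^ k4 * C k1 * C k2 * D k3 / (fact k1 * fact k2 * fact k3 * fact k4)"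

end

(* Put a_n = binom(2n, n) / 4^n.  The Bell polynomials C_n and D_n have generating functions
   e^{gamma t} Gamma(1+t) and its reciprocal, so the right-hand side is, up to sign, a Taylor
   coefficient of F(t) = 4^t Gamma(1+t)^2 / Gamma(1+2t).  Integrating x^{s-1} (1-x)^{-1/2} termwise
   gives sum_n a_n / (n+s) = B(s, 1/2); with Legendre duplication this becomes
   F(t) = 1 + sum_{n>=1} a_n t / (n+t), whose Taylor coefficients are, up to sign, the left-hand
   sides.  The two power series are compared through the linear differential equation given by
   the logarithmic derivative of F, so no composition of analytic functions is needed: the
   digamma function is itself a series of simple fractions, with zeta values as coefficients. *)
theory Submission
  imports Defs "HOL-Real_Asymp.Real_Asymp" "HOL-Complex_Analysis.Cauchy_Integral_Formula"
begin

unbundle no vec_syntax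
unbundle fps_syntax

section \<open>Central binomial coefficients divided by powers of 4\<close>

definition cbin :: "nat \<Rightarrow> real" where
  "cbin n = real ((2 * n) choose n) / 4 ^ n"

lemma cbin_0 [simp]: "cbin 0 = 1"
  by (simp add: cbin_def)

lemma cbin_pos: "cbin n > 0"
  by (simp add: cbin_def)

lemma cbin_Suc: "cbin (Suc n) = cbin n * (2 * real n + 1) / (2 * real n + 2)"
proof -
  have *: "cbin k = fact (2 * k) / (fact k ^ 2 * 4 ^ k)" for k
    by (simp add: cbin_def binomial_fact power2_eq_square mult_2 [of k, symmetric])
  show ?thesis
    unfolding *[of n] *[of "Suc n"]
    by (simp add: power2_eq_square divide_simps) (simp add: algebra_simps)
qed

text \<open>Both sides start at 1 and obey the same first-order recurrence. This makes
  \<open>cbin\<close> the coefficient sequence of the binomial series for (1-x)^(-1/2).\<close>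

lemma cbin_gbinomial: "cbin n = (-1) ^ n * ((-1/2) gchoose n)"
proof (induction n)
  case (Suc n)
  have "real (Suc n) * ((-1/2) gchoose Suc n) = (-1/2 - real n) * ((-1/2) gchoose n)"
    using gbinomial_mult_1[of "-1/2::real" n] by (simp add: algebra_simps)
  then have "((-1/2) gchoose Suc n) = (-1/2 - real n) * ((-1/2) gchoose n) / real (Suc n)"
    by (simp add: field_simps)
  then show ?case
    by (simp only: cbin_Suc Suc.IH) (simp add: field_simps)
qed simp

lemma cbin_sums:
  assumes "\<bar>x\<bar> < 1"
  shows "(\<lambda>n. cbin n * x ^ n) sums (1 - x) powr (-1/2)"
  using gen_binomial_real[of "-x" "-1/2"] assms
  by (simp add: cbin_gbinomial power_minus[of x] mult_ac)

text \<open>A Wallis-type bound: \<open>cbin n ^ 2 * (2 * real n + 1)\<close> starts at 1 and never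
  increases, because (2n+1)(2n+3) <= (2n+2)^2. It yields the limit 0 on which the telescoping
  rests.\<close>

lemma cbin_le: "cbin n \<le> 1 / sqrt (2 * real n + 1)"
proof -
  have "cbin n ^ 2 * (2 * real n + 1) \<le> 1"
  proof (induction n)
    case (Suc n)
    have "cbin (Suc n) ^ 2 * (2 * real (Suc n) + 1)
        = (cbin n ^ 2 * (2 * real n + 1)) * ((2 * real n + 1) * (2 * real n + 3) / (2 * real n + 2) ^ 2)"
      by (simp add: cbin_Suc divide_simps) (simp add: power2_eq_square algebra_simps)
    also have "(2 * real n + 1) * (2 * real n + 3) \<le> (2 * real n + 2) ^ 2"
      by (simp add: power2_eq_square algebra_simps)
    then have "(cbin n ^ 2 * (2 * real n + 1)) * ((2 * real n + 1) * (2 * real n + 3) / (2 * real n + 2) ^ 2)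
        \<le> 1 * 1"
      using Suc by (intro mult_mono) auto
    finally show ?case by simp
  qed simp
  then have "cbin n ^ 2 \<le> (1 / sqrt (2 * real n + 1)) ^ 2"
    by (simp add: power_divide field_simps)
  then show ?thesis
    by (rule power2_le_imp_le) simp
qed

lemma cbin_tendsto_0: "cbin \<longlonglongrightarrow> 0"
proof (rule tendsto_sandwich[of "\<lambda>_. 0"])
  show "(\<lambda>n. 1 / sqrt (2 * real n + 1)) \<longlonglongrightarrow> 0"
    by real_asymp
qed (auto simp: cbin_le less_imp_le[OF cbin_pos])

lemma cbin_telescope: "(\<lambda>n. cbin n - cbin (Suc n)) sums 1"
  using telescope_sums'[OF cbin_tendsto_0] by simp

lemma summable_cbin_div: "summable (\<lambda>n. cbin (Suc n) / real (Suc n))"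
proof (rule summable_comparison_test')
  show "summable (\<lambda>n. 2 * (cbin n - cbin (Suc n)))"
    using cbin_telescope by (intro summable_mult) (rule sums_summable)
  fix n
  \<comment> \<open>The recurrence gives
    \<open>cbin n - cbin (Suc n) = cbin (Suc n) / (2 * real n + 1)\<close>, so twice the telescoping
    difference is a majorant.\<close>
  have "cbin (Suc n) / real (Suc n) \<le> 2 * (cbin n - cbin (Suc n))"
    using cbin_pos[of n] by (simp add: cbin_Suc divide_simps) (simp add: algebra_simps)
  then show "norm (cbin (Suc n) / real (Suc n)) \<le> 2 * (cbin n - cbin (Suc n))"
    using cbin_pos[of "Suc n"] by simp
qed

section \<open>Power series expansion of sums of simple fractions\<close>

text \<open>Each t/(n+1+t) is a geometric series in -t/(n+1). The double series converges
  absolutely: summed by rows it gives the fractions, by columns the powers of t. General weights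
  \<open>u\<close> cover both the binomial series and the digamma function.\<close>

lemma sums_expand_simple_fractions:
  fixes u :: "nat \<Rightarrow> real"
  assumes u: "summable (\<lambda>n. u n / real (Suc n))" "\<And>n. u n \<ge> 0" and t: "\<bar>t\<bar> < 1"
  shows "(\<lambda>p. (-1) ^ p * (\<Sum>n. u n / real (Suc n) ^ Suc p) * t ^ Suc p) sums
           (\<Sum>n. u n * t / (real (Suc n) + t))"
proof -
  define f where "f = (\<lambda>(n, p). u n / real (Suc n) * t * (- t / real (Suc n)) ^ p)"
  \<comment> \<open>Bounding one factor |t| and the p-th power of 1/(n+1) by 1 separates the
    indices: the majorant is a product of two summable sequences.\<close>
  define g where "g = (\<lambda>(n, p :: nat). u n / real (Suc n) * \<bar>t\<bar> ^ p)"
  have "g summable_on UNIV \<times> UNIV"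
  proof (rule summable_on_SigmaI)
    show "((\<lambda>p. g (n, p)) has_sum u n / real (Suc n) * (1 / (1 - \<bar>t\<bar>))) UNIV" for n
      unfolding g_def prod.case using t
      by (intro has_sum_cmult_right sums_nonneg_imp_has_sum geometric_sums) auto
    show "(\<lambda>n. u n / real (Suc n) * (1 / (1 - \<bar>t\<bar>))) summable_on UNIV"
      using u by (intro summable_on_cmult_left norm_summable_imp_summable_on) simp
  qed (use u in \<open>auto simp: g_def\<close>)
  moreover have "norm (f x) \<le> g x" for x
  proof (cases x)
    case (Pair n p)
    have "\<bar>t\<bar> / real (Suc n) \<le> \<bar>t\<bar> / 1"
      by (intro divide_left_mono) auto
    then have "\<bar>t\<bar> * (\<bar>t\<bar> / real (Suc n)) ^ p \<le> 1 * \<bar>t\<bar> ^ p"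
      using t by (intro mult_mono power_mono) auto
    then have "u n / real (Suc n) * (\<bar>t\<bar> * (\<bar>t\<bar> / real (Suc n)) ^ p) \<le> u n / real (Suc n) * \<bar>t\<bar> ^ p"
      using u(2)[of n] by (intro mult_left_mono) auto
    then show ?thesis
      using u(2)[of n] by (simp add: f_def g_def Pair abs_mult power_abs mult_ac)
  qed
  ultimately have sf: "f summable_on UNIV \<times> UNIV"
    by (rule abs_summable_summable[OF Infinite_Sum.abs_summable_on_comparison_test'])
  then obtain S where S: "(f has_sum S) (UNIV \<times> UNIV)"
    by (auto simp: summable_on_def)
  have row: "((\<lambda>p. f (n, p)) has_sum u n * t / (real (Suc n) + t)) UNIV" for n
  proof -
    have lt: "norm (- t / real (Suc n)) < 1"
      using t by (simp add: divide_simps)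
    have "(\<lambda>p. f (n, p)) sums (u n / real (Suc n) * t * (1 / (1 - (- t / real (Suc n)))))"
      unfolding f_def prod.case by (intro sums_mult geometric_sums lt)
    also have "u n / real (Suc n) * t * (1 / (1 - (- t / real (Suc n)))) = u n * t / (real (Suc n) + t)"
      using t by (simp add: divide_simps)
    finally have s: "(\<lambda>p. f (n, p)) sums (u n * t / (real (Suc n) + t))" .
    moreover have "summable (\<lambda>p. norm (f (n, p)))"
      unfolding f_def prod.case norm_mult norm_power
      using lt by (intro summable_mult summable_geometric) simp
    ultimately show ?thesis
      by (intro norm_summable_imp_has_sum)
  qed
  have rows: "(\<lambda>n. u n * t / (real (Suc n) + t)) sums S"
    by (rule has_sum_imp_sums, rule has_sum_SigmaD[OF S row])
  have sm: "summable (\<lambda>n. u n / real (Suc n) ^ Suc p)" for p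
  proof (rule summable_comparison_test'[OF u(1)])
    fix n
    have "u n / real (Suc n) ^ Suc p \<le> u n / real (Suc n) ^ 1"
      using u(2)[of n] by (intro divide_left_mono power_increasing) auto
    then show "norm (u n / real (Suc n) ^ Suc p) \<le> u n / real (Suc n)"
      using u(2)[of n] by simp
  qed
  have col: "((\<lambda>n. (\<lambda>(x, y). f (y, x)) (p, n)) has_sum
      (-1) ^ p * (\<Sum>n. u n / real (Suc n) ^ Suc p) * t ^ Suc p) UNIV" for p
  proof -
    have "((\<lambda>n. (-1) ^ p * t ^ Suc p * (u n / real (Suc n) ^ Suc p)) has_sum
        (-1) ^ p * t ^ Suc p * (\<Sum>n. u n / real (Suc n) ^ Suc p)) UNIV"
      using sm[of p] u(2)
      by (intro has_sum_cmult_right sums_nonneg_imp_has_sum summable_sums) auto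
    then show ?thesis
      by (simp add: f_def power_divide power_minus[of "t / y" for y] mult_ac)
  qed
  have "(\<lambda>p. (-1) ^ p * (\<Sum>n. u n / real (Suc n) ^ Suc p) * t ^ Suc p) sums S"
    by (rule has_sum_imp_sums, rule has_sum_SigmaD[OF S[unfolded has_sum_swap[of f]] col])
  then show ?thesis
    using rows by (simp add: sums_iff)
qed

section \<open>Beta integrals and the closed form in Gamma values\<close>

text \<open>The binomial series of (1-x)^(-1/2) has positive coefficients, so monotone convergence
  permits termwise integration in the Beta integral.\<close>

lemma Beta_half_sums:
  assumes s: "s > (0::real)"
  shows "(\<lambda>n. cbin n / (real n + s)) sums Beta s (1/2)"
proof -
  have sm: "summable (\<lambda>n. cbin n / (real n + s))"
  proof -
    have "summable (\<lambda>n. cbin (Suc n) / (real (Suc n) + s))"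
      using summable_cbin_div
    proof (rule summable_comparison_test')
      show "norm (cbin (Suc n) / (real (Suc n) + s)) \<le> cbin (Suc n) / real (Suc n)" for n
        using cbin_pos[of "Suc n"] s by (auto intro!: divide_left_mono)
    qed
    then show ?thesis
      by (subst (asm) summable_Suc_iff)
  qed
  define f where "f = (\<lambda>k (x::real). \<Sum>n<k. cbin n * x powr (real n + s - 1))"
  have "((\<lambda>x. x powr (s - 1) * (1 - x) powr (1/2 - 1)) has_integral
      (\<Sum>n. cbin n / (real n + s))) {0<..<1}"
  proof (rule has_integral_monotone_convergence_increasing)
    show "(f k has_integral (\<Sum>n<k. cbin n / (real n + s))) {0<..<1}" for k
    proof -
      have "((\<lambda>x. cbin n * x powr (real n + s - 1)) has_integral cbin n * (1 / (real n + s))) {0..1}" for n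
        using has_integral_powr_from_0[of "real n + s - 1" 1] s
        by (intro has_integral_mult_right) simp
      then have "(f k has_integral (\<Sum>n<k. cbin n * (1 / (real n + s)))) {0..1}"
        unfolding f_def by (intro has_integral_sum) auto
      \<comment> \<open>The endpoints are removed because the partial sums diverge at x = 1; the
        integrals stay the same.\<close>
      then show ?thesis
        by (simp add: has_integral_Icc_iff_Ioo)
    qed
    show "f k x \<le> f (Suc k) x" for k x
      using cbin_pos[of k] by (simp add: f_def)
    show "(\<lambda>k. \<Sum>n<k. cbin n / (real n + s)) \<longlonglongrightarrow> (\<Sum>n. cbin n / (real n + s))"
      using summable_sums[OF sm] by (simp add: sums_def)
    fix x :: real assume x: "x \<in> {0<..<1}"
    have "(\<lambda>n. x powr (s - 1) * (cbin n * x ^ n)) sums (x powr (s - 1) * (1 - x) powr (-1/2))"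
      using x by (intro sums_mult cbin_sums) auto
    moreover have "x powr (s - 1) * (cbin n * x ^ n) = cbin n * x powr (real n + s - 1)" for n
      using x by (simp add: powr_add powr_diff powr_realpow)
    ultimately show "(\<lambda>k. f k x) \<longlonglongrightarrow> x powr (s - 1) * (1 - x) powr (1/2 - 1)"
      by (simp add: f_def sums_def)
  qed
  moreover have "((\<lambda>x. x powr (s - 1) * (1 - x) powr (1/2 - 1)) has_integral Beta s (1/2)) {0<..<1}"
    using has_integral_Beta_real[of s "1/2"] s by (simp add: has_integral_Icc_iff_Ioo)
  ultimately have "(\<Sum>n. cbin n / (real n + s)) = Beta s (1/2)"
    by (rule has_integral_unique)
  with sm show ?thesis
    by (simp add: sums_iff)
qed

lemma Gamma_legendre_duplication_real:
  assumes "x > (0::real)"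
  shows "Gamma x * Gamma (x + 1/2) = exp ((1 - 2 * x) * ln 2) * sqrt pi * Gamma (2 * x)"
proof -
  have "complex_of_real x \<notin> \<int>\<^sub>\<le>\<^sub>0" "complex_of_real (x + 1/2) \<notin> \<int>\<^sub>\<le>\<^sub>0"
    using assms by (simp_all only: of_real_in_nonpos_Ints_iff) (auto elim!: nonpos_Ints_cases)
  then have "Gamma (complex_of_real x) * Gamma (complex_of_real (x + 1/2)) =
      exp (complex_of_real ((1 - 2 * x) * ln 2)) * complex_of_real (sqrt pi) * Gamma (complex_of_real (2 * x))"
    using Gamma_legendre_duplication[of "complex_of_real x"] by simp
  then have "complex_of_real (Gamma x * Gamma (x + 1/2))
      = complex_of_real (exp ((1 - 2 * x) * ln 2) * sqrt pi * Gamma (2 * x))"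
    by (simp only: Gamma_complex_of_real exp_of_real flip: of_real_mult)
  then show ?thesis
    by (simp only: of_real_eq_iff)
qed

text \<open>Beta is used at \<open>t + 1\<close> rather than at \<open>t\<close>, and the shift undone by telescoping, so that the
  identity holds on both sides of \<open>0\<close>.\<close>

lemma sum_cbin_fractions_eq_Gamma:
  assumes t: "t > (-1/2::real)"
  shows "1 + (\<Sum>n. cbin (Suc n) * t / (real (Suc n) + t))
       = exp (2 * ln 2 * t) * Gamma (1 + t) ^ 2 / Gamma (1 + 2 * t)"
proof -
  \<comment> \<open>The factor t+1/2 comes from writing t = (n+1+t) - (n+1) in t/(n+1+t) and using
    \<open>real (Suc n) * cbin (Suc n) = (real n + 1/2) * cbin n\<close>.\<close>
  have B: "(\<lambda>n. (t + 1/2) * (cbin n / (real n + (t + 1)))) sums ((t + 1/2) * Beta (t + 1) (1/2))"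
    using t by (intro sums_mult Beta_half_sums) auto
  have "(t + 1/2) * (cbin n / (real n + (t + 1)))
      = (cbin n - cbin (Suc n)) + cbin (Suc n) * t / (real (Suc n) + t)" for n
    using t by (simp add: cbin_Suc divide_simps) (simp add: algebra_simps)
  with sums_diff[OF B cbin_telescope]
  have "(\<lambda>n. cbin (Suc n) * t / (real (Suc n) + t)) sums ((t + 1/2) * Beta (t + 1) (1/2) - 1)"
    by simp
  then have "1 + (\<Sum>n. cbin (Suc n) * t / (real (Suc n) + t)) = (t + 1/2) * Beta (t + 1) (1/2)"
    by (simp add: sums_iff)
  also have "Gamma (t + 1/2 + 1) = (t + 1/2) * Gamma (t + 1/2)"
    using t by (intro Gamma_plus1) (auto elim!: nonpos_Ints_cases)
  then have "(t + 1/2) * Beta (t + 1) (1/2) = Gamma (t + 1) * sqrt pi / Gamma (t + 1/2)"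
    using t by (simp add: Beta_def Gamma_one_half_real add_ac)
  also have "\<dots> = exp (2 * ln 2 * t) * Gamma (1 + t) ^ 2 / Gamma (1 + 2 * t)"
  proof -
    have "Gamma (t + 1/2) * Gamma (1 + t) = exp (- (2 * ln 2 * t)) * sqrt pi * Gamma (1 + 2 * t)"
      using Gamma_legendre_duplication_real[of "t + 1/2"] t by (simp add: algebra_simps)
    moreover have "Gamma (t + 1/2) > 0" "Gamma (1 + 2 * t) > 0"
      using t by (auto intro!: Gamma_real_pos)
    ultimately show ?thesis
      by (simp add: exp_minus power2_eq_square field_simps)
  qed
  finally show ?thesis .
qed

section \<open>Taylor series of the digamma function\<close>

text \<open>Taylor series at 0 of psi(1+t) + gamma, the logarithmic derivative of e^(gamma t)
  Gamma(1+t). The constant term is set to 0 because the general formula would involve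
  zeta(1).\<close>

definition psi_fps :: "real fps" where
  "psi_fps = Abs_fps (\<lambda>k. if k = 0 then 0 else (-1) ^ (k - 1) * zeta (real (k + 1)))"

lemma zeta_of_nat: "zeta (real k) = (\<Sum>n. 1 / real (Suc n) ^ k)"
  by (simp add: zeta_def powr_realpow)

lemma Digamma_one_plus_sums:
  assumes t: "\<bar>t\<bar> < 1"
  shows "(\<lambda>k. psi_fps $ k * t ^ k) sums (Digamma (1 + t) + euler_mascheroni)"
proof -
  have "summable (\<lambda>n. 1 / real (Suc n) / real (Suc n))"
    using summable_ignore_initial_segment[OF inverse_power_summable[of 2, where 'a = real], of 1]
    by (simp add: power2_eq_square field_simps)
  note expand = sums_expand_simple_fractions[OF this _ t]
  have "(\<Sum>n. 1 / real (Suc n) * t / (real (Suc n) + t)) = Digamma (1 + t) + euler_mascheroni"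
  proof -
    have "1 / real (Suc n) * t / (real (Suc n) + t)
        = inverse (of_nat (Suc n)) - inverse (1 + t + of_nat n)" for n
      using t by (simp add: divide_simps)
    then show ?thesis
      by (simp add: Digamma_def)
  qed
  \<comment> \<open>The weight 1/(n+1) raises the exponent by one, so t^(p+1) carries
    zeta(p+2).\<close>
  moreover have "(-1) ^ p * (\<Sum>n. 1 / real (Suc n) / real (Suc n) ^ Suc p) = psi_fps $ Suc p" for p
    unfolding psi_fps_def using zeta_of_nat[of "Suc p + 1"] by (simp add: mult_ac)
  ultimately have "(\<lambda>p. psi_fps $ Suc p * t ^ Suc p) sums (Digamma (1 + t) + euler_mascheroni)"
    using expand by simp
  then show ?thesis
    by (subst (asm) sums_Suc_iff) (simp add: psi_fps_def)
qed

section \<open>Uniqueness of formal solutions and of real power series expansions\<close>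

text \<open>At index m the equation expresses (m+1) times the coefficient of index m+1 through those
  of index at most m, and characteristic 0 allows division by m+1.\<close>

lemma fps_linear_ode_unique:
  fixes F H N :: "'a :: field_char_0 fps"
  assumes "fps_deriv F = N * F" "fps_deriv H = N * H" "F $ 0 = H $ 0"
  shows "F = H"
proof (rule fps_ext)
  fix n show "F $ n = H $ n"
  proof (induction n rule: less_induct)
    case (less n)
    show ?case
    proof (cases n)
      case (Suc m)
      have "of_nat (Suc m) * F $ Suc m = (N * F) $ m" "of_nat (Suc m) * H $ Suc m = (N * H) $ m"
        using assms(1,2)[THEN arg_cong[where f = "\<lambda>A. A $ m"]] by simp_all
      moreover have "(N * F) $ m = (N * H) $ m"
        unfolding fps_mult_nth using Suc by (intro sum.cong refl arg_cong2[where f = "(*)"] less) auto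
      ultimately show ?thesis
        using Suc by (metis mult_cancel_left of_nat_eq_0_iff nat.distinct(1))
    qed (use assms(3) in simp)
  qed
qed

text \<open>The difference series vanishes near 0, whereas a nonzero convergent power series has no
  zeros in some punctured neighbourhood of 0.\<close>

lemma has_fps_expansion_unique_real:
  fixes f :: "real \<Rightarrow> real"
  assumes "f has_fps_expansion F" "f has_fps_expansion H"
  shows "F = H"
proof (rule ccontr)
  assume "F \<noteq> H"
  define K where "K = F - H"
  have K: "(\<lambda>_. 0) has_fps_expansion K"
    unfolding K_def using has_fps_expansion_diff[OF assms] by simp
  then have "eventually (\<lambda>z. eval_fps K z = 0) (nhds 0)" and rad: "fps_conv_radius K > 0"
    by (auto simp: has_fps_expansion_def)
  then obtain e where e: "e > 0" "\<And>z. \<bar>z\<bar> < e \<Longrightarrow> eval_fps K z = 0"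
    by (auto simp: eventually_nhds_metric)
  obtain e' where e': "e' > 0" "ereal e' < fps_conv_radius K"
    using rad by (metis ereal_dense2 ereal_less(2) zero_ereal_def)
  have K0: "K $ 0 = 0"
    using e(1) e(2)[of 0] by (simp add: eval_fps_at_0)
  obtain m where m: "K $ m \<noteq> 0"
    using \<open>F \<noteq> H\<close> unfolding K_def by (auto simp: fps_eq_iff)
  have sums: "(\<lambda>n. K $ n * (x - 0) ^ n) sums eval_fps K x" if "norm (x - 0) < e'" for x
  proof -
    have "ereal (norm x) < fps_conv_radius K"
      using that by (intro less_trans[OF _ e'(2)]) simp
    then show ?thesis
      using sums_eval_fps[of x K] by simp
  qed
  have K0': "eval_fps K 0 = 0"
    using K0 by (simp add: eval_fps_at_0)
  have "m > 0"
    using m K0 by (cases m) auto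
  obtain s where s: "0 < s" "\<And>z. z \<in> cball 0 s - {0} \<Longrightarrow> eval_fps K z \<noteq> 0"
    using powser_0_nonzero[OF e'(1) sums K0' m \<open>m > 0\<close>] by blast
  then have "eval_fps K (min (s / 2) (e / 2)) \<noteq> 0"
    using e(1) s(1) by (intro s(2)) (auto simp: dist_real_def)
  with e s(1) show False
    by auto
qed

section \<open>Differential equation of the simple-fraction series\<close>

definition cbin_fps :: "real fps" where
  "cbin_fps = Abs_fps (\<lambda>k. if k = 0 then 1 else (-1) ^ (k - 1) * (\<Sum>n. cbin (Suc n) / real (Suc n) ^ k))"

definition cbin_fun :: "real \<Rightarrow> real" where
  "cbin_fun t = 1 + (\<Sum>n. cbin (Suc n) * t / (real (Suc n) + t))"

text \<open>Logarithmic derivative of F. Euler's constant enters with coefficients 2 and -2 and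
  cancels; the factor 2 of the substituted series is the inner derivative of 1+2t.\<close>

definition ratio_logderiv_fps :: "real fps" where
  "ratio_logderiv_fps = 2 * psi_fps - 2 * (psi_fps oo (fps_const 2 * fps_X)) + fps_const (2 * ln 2)"

lemma eventually_abs_less: "r > 0 \<Longrightarrow> eventually (\<lambda>t::real. \<bar>t\<bar> < r) (nhds 0)"
  by (auto simp: eventually_nhds_metric)

lemma cbin_fun_has_fps_expansion: "cbin_fun has_fps_expansion cbin_fps"
proof (rule has_fps_expansionI, rule eventually_mono[OF eventually_abs_less[of 1]])
  fix t :: real assume t: "\<bar>t\<bar> < 1"
  from sums_expand_simple_fractions[OF summable_cbin_div less_imp_le[OF cbin_pos] t]
  have "(\<lambda>p. cbin_fps $ Suc p * t ^ Suc p) sums (cbin_fun t - 1)"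
    by (simp add: cbin_fps_def cbin_fun_def)
  then show "(\<lambda>p. cbin_fps $ p * t ^ p) sums cbin_fun t"
    by (subst (asm) sums_Suc_iff) (simp add: cbin_fps_def)
qed simp

lemma ratio_logderiv_has_fps_expansion:
  "(\<lambda>t. 2 * Digamma (1 + t) - 2 * Digamma (1 + 2 * t) + 2 * ln 2) has_fps_expansion ratio_logderiv_fps"
proof -
  define d :: "real \<Rightarrow> real" where "d = (\<lambda>t. Digamma (1 + t) + euler_mascheroni)"
  have 1: "d has_fps_expansion psi_fps"
    by (rule has_fps_expansionI, rule eventually_mono[OF eventually_abs_less[of 1]])
      (use Digamma_one_plus_sums in \<open>auto simp: d_def\<close>)
  have 2: "(\<lambda>t. d (2 * t)) has_fps_expansion (psi_fps oo (fps_const 2 * fps_X))"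
  proof (rule has_fps_expansionI, rule eventually_mono[OF eventually_abs_less[of "1/2"]])
    fix t :: real assume "\<bar>t\<bar> < 1/2"
    then have "(\<lambda>n. psi_fps $ n * (2 * t) ^ n) sums d (2 * t)"
      unfolding d_def by (intro Digamma_one_plus_sums) simp
    moreover have "psi_fps $ n * (2 * t) ^ n = (psi_fps oo (fps_const 2 * fps_X)) $ n * t ^ n" for n
      by (simp add: power_mult_distrib)
    ultimately show "(\<lambda>n. (psi_fps oo (fps_const 2 * fps_X)) $ n * t ^ n) sums d (2 * t)"
      by (simp only:)
  qed simp
  have "(\<lambda>t. 2 * d t - 2 * d (2 * t) + 2 * ln 2) has_fps_expansion ratio_logderiv_fps"
    unfolding ratio_logderiv_fps_def by (intro fps_expansion_intros 1 2)
  then show ?thesis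
    by (simp add: d_def algebra_simps)
qed

lemma Gamma_ratio_deriv:
  assumes t: "\<bar>t::real\<bar> < 1/2"
  shows "((\<lambda>t. exp (2 * ln 2 * t) * Gamma (1 + t) ^ 2 / Gamma (1 + 2 * t)) has_field_derivative
      (2 * Digamma (1 + t) - 2 * Digamma (1 + 2 * t) + 2 * ln 2) *
      (exp (2 * ln 2 * t) * Gamma (1 + t) ^ 2 / Gamma (1 + 2 * t))) (at t)"
proof -
  have nz: "1 + t \<notin> \<int>\<^sub>\<le>\<^sub>0" "1 + 2 * t \<notin> \<int>\<^sub>\<le>\<^sub>0"
    using t by (auto elim!: nonpos_Ints_cases)
  have pos: "Gamma (1 + 2 * t) > 0"
    using t by (intro Gamma_real_pos) auto
  have E: "((\<lambda>t. exp (2 * ln 2 * t)) has_field_derivative exp (2 * ln 2 * t) * (2 * ln 2)) (at t)"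
    by (auto intro!: derivative_eq_intros has_field_derivative_Gamma nz)
  have 1: "((\<lambda>t. Gamma (1 + t)) has_field_derivative Gamma (1 + t) * Digamma (1 + t) * 1) (at t)"
    by (rule DERIV_chain2[where f = Gamma and g = "\<lambda>t. 1 + t"])
      (auto intro!: derivative_eq_intros has_field_derivative_Gamma nz)
  have 2: "((\<lambda>t. Gamma (1 + 2 * t)) has_field_derivative
      Gamma (1 + 2 * t) * Digamma (1 + 2 * t) * 2) (at t)"
    by (rule DERIV_chain2[where f = Gamma and g = "\<lambda>t. 1 + 2 * t"])
      (auto intro!: derivative_eq_intros has_field_derivative_Gamma nz)
  show ?thesis
    by (rule DERIV_cong[OF DERIV_divide[OF DERIV_mult[OF E DERIV_power[OF 1, of 2]] 2]])
      (use pos in \<open>simp_all add: field_simps power2_eq_square\<close>)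
qed
lemma cbin_fun_deriv:
  assumes t: "\<bar>t\<bar> < 1/2"
  shows "deriv cbin_fun t = (2 * Digamma (1 + t) - 2 * Digamma (1 + 2 * t) + 2 * ln 2) * cbin_fun t"
proof -
  define f :: "real \<Rightarrow> real" where
    "f = (\<lambda>t. exp (2 * ln 2 * t) * Gamma (1 + t) ^ 2 / Gamma (1 + 2 * t))"
  have eq: "cbin_fun x = f x" if "\<bar>x\<bar> < 1/2" for x
    using sum_cbin_fractions_eq_Gamma[of x] that by (simp add: cbin_fun_def f_def)
  have "deriv f t = (2 * Digamma (1 + t) - 2 * Digamma (1 + 2 * t) + 2 * ln 2) * f t"
    unfolding f_def by (rule DERIV_imp_deriv[OF Gamma_ratio_deriv[OF t]])
  \<comment> \<open>Derivatives are compared, so the closed form must hold on a neighbourhood of t,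
    not only at t.\<close>
  moreover have "eventually (\<lambda>x. x \<in> ball 0 (1/2)) (nhds t)"
    using t by (intro eventually_nhds_in_open) auto
  then have "eventually (\<lambda>x. cbin_fun x = f x) (nhds t)"
    by (rule eventually_mono) (use eq in auto)
  then have "deriv cbin_fun t = deriv f t"
    by (intro deriv_cong_ev) auto
  ultimately show ?thesis
    using eq[OF t] by simp
qed

text \<open>The identity of functions near 0 passes to formal series by uniqueness of the
  expansion.\<close>

lemma cbin_fps_deriv: "fps_deriv cbin_fps = ratio_logderiv_fps * cbin_fps"
proof (rule has_fps_expansion_unique_real)
  show "deriv cbin_fun has_fps_expansion fps_deriv cbin_fps"
    by (intro fps_expansion_intros cbin_fun_has_fps_expansion)
  have "eventually (\<lambda>t. (2 * Digamma (1 + t) - 2 * Digamma (1 + 2 * t) + 2 * ln 2) * cbin_fun t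
      = deriv cbin_fun t) (nhds 0)"
    by (rule eventually_mono[OF eventually_abs_less[of "1/2"]]) (simp_all add: cbin_fun_deriv)
  then show "deriv cbin_fun has_fps_expansion ratio_logderiv_fps * cbin_fps"
    using has_fps_expansion_mult[OF ratio_logderiv_has_fps_expansion cbin_fun_has_fps_expansion]
    unfolding has_fps_expansion_def by (auto elim: eventually_elim2)
qed

section \<open>Bell polynomials and the product series\<close>

text \<open>The generating series is exp(b), with derivative b' exp(b); differentiating b shifts the
  arguments and lowers the factorial by one index.\<close>

lemma bell_fps_deriv:
  fixes x :: "nat \<Rightarrow> real"
  shows "fps_deriv (Abs_fps (\<lambda>n. bell_Y n x / fact n))
       = Abs_fps (\<lambda>n. x (Suc n) / fact n) * Abs_fps (\<lambda>n. bell_Y n x / fact n)"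
proof -
  define b where "b = Abs_fps (\<lambda>k. if k = 0 then 0 else x k / fact k)"
  have "fps_deriv (fps_exp 1 oo b) = (fps_exp 1 oo b) * fps_deriv b"
    by (subst fps_compose_deriv) (simp_all add: b_def)
  moreover have "fps_deriv b = Abs_fps (\<lambda>n. x (Suc n) / fact n)"
    by (rule fps_ext) (simp add: b_def del: of_nat_Suc)
  moreover have "Abs_fps (\<lambda>n. bell_Y n x / fact n) = fps_exp 1 oo b"
    by (simp only: b_def bell_Y_generating_function)
  ultimately show ?thesis
    by (simp add: mult_ac)
qed

definition C_fps :: "real fps" where "C_fps = Abs_fps (\<lambda>n. C n / fact n)"
definition D_fps :: "real fps" where "D_fps = Abs_fps (\<lambda>n. D n / fact n)"

lemma C_fps_deriv: "fps_deriv C_fps = psi_fps * C_fps"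
proof -
  \<comment> \<open>The exponents n+1 and n-1 have equal parity, so the signs agree; the argument 0
    at index 1 matches the constant term 0 of \<open>psi_fps\<close>.\<close>
  have "Abs_fps (\<lambda>n. (if Suc n = 1 then 0 else (-1) ^ Suc n * fact (Suc n - 1) *
      zeta (real (Suc n))) / fact n)
      = psi_fps"
    by (rule fps_ext) (auto simp: psi_fps_def gr0_conv_Suc)
  then show ?thesis
    unfolding C_fps_def C_def bell_fps_deriv by simp
qed

lemma D_fps_deriv: "fps_deriv D_fps = - psi_fps * D_fps"
proof -
  have "Abs_fps (\<lambda>n. (if Suc n = 1 then 0 else (-1) ^ (Suc n - 1) * fact (Suc n - 1) *
      zeta (real (Suc n))) / fact n)
      = - psi_fps"
    by (rule fps_ext) (auto simp: psi_fps_def gr0_conv_Suc)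
  then show ?thesis
    unfolding D_fps_def D_def bell_fps_deriv by simp
qed

text \<open>Generating series of \<open>G\<close>: substituting 2X supplies 2^k3, and the
  exponential supplies (2 ln 2)^k4/k4!.\<close>

definition G_fps :: "real fps" where
  "G_fps = C_fps * (C_fps * ((D_fps oo (fps_const 2 * fps_X)) * fps_exp (2 * ln 2)))"

text \<open>Logarithmic derivatives add: \<open>psi_fps\<close> from each \<open>C_fps\<close>,
  minus twice the substituted \<open>psi_fps\<close> by the chain rule, and 2 ln 2 from the
  exponential.\<close>

lemma G_fps_deriv: "fps_deriv G_fps = ratio_logderiv_fps * G_fps"
proof -
  have "fps_deriv (D_fps oo (fps_const 2 * fps_X))
      = - 2 * (psi_fps oo (fps_const 2 * fps_X)) * (D_fps oo (fps_const 2 * fps_X))"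
    by (subst fps_compose_deriv)
      (simp_all add: D_fps_deriv fps_compose_mult_distrib fps_compose_uminus numeral_fps_const mult_ac
        flip: fps_const_neg)
  then show ?thesis
    by (simp add: G_fps_def ratio_logderiv_fps_def C_fps_deriv algebra_simps)
qed

lemma cbin_fps_eq_G_fps: "cbin_fps = G_fps"
proof (rule fps_linear_ode_unique[OF cbin_fps_deriv G_fps_deriv])
  show "cbin_fps $ 0 = G_fps $ 0"
    by (simp add: cbin_fps_def G_fps_def C_fps_def D_fps_def C_def D_def bell_Y_def)
qed

section \<open>Comparison of coefficients\<close>

lemma fps_mult4_nth:
  fixes A B E F :: "'a :: comm_ring_1 fps"
  shows "(A * (B * (E * F))) $ p =
    (\<Sum>(k1, k2, k3, k4) \<in> {(k1, k2, k3, k4). k1 + k2 + k3 + k4 = p}. A $ k1 * (B $ k2 * (E $ k3 * F $ k4)))"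
proof -
  have "(A * (B * (E * F))) $ p = (\<Sum>k1=0..p. \<Sum>k2=0..p-k1. \<Sum>k3=0..p-k1-k2.
      A $ k1 * (B $ k2 * (E $ k3 * F $ (p - k1 - k2 - k3))))"
    by (simp add: fps_mult_nth sum_distrib_left)
  also have "\<dots> = (\<Sum>(k1, k2, k3) \<in> (SIGMA k1:{0..p}. SIGMA k2:{0..p-k1}. {0..p-k1-k2}).
      A $ k1 * (B $ k2 * (E $ k3 * F $ (p - k1 - k2 - k3))))"
    by (simp add: sum.Sigma)
  \<comment> \<open>The sum condition determines the fourth index from the other three.\<close>
  also have "\<dots> = (\<Sum>(k1, k2, k3, k4) \<in> {(k1, k2, k3, k4). k1 + k2 + k3 + k4 = p}.
      A $ k1 * (B $ k2 * (E $ k3 * F $ k4)))"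
    by (rule sum.reindex_bij_witness[where j = "\<lambda>(k1, k2, k3). (k1, k2, k3, p - k1 - k2 - k3)"
          and i = "\<lambda>(k1, k2, k3, k4). (k1, k2, k3)"]) auto
  finally show ?thesis .
qed

lemma G_fps_nth:
  "G_fps $ p = (\<Sum>(k1, k2, k3, k4) \<in> {(k1, k2, k3, k4). k1 + k2 + k3 + k4 = p}. G k1 k2 k3 k4)"
  unfolding G_fps_def fps_mult4_nth
  by (intro sum.cong refl)
    (simp add: G_def C_fps_def D_fps_def power_mult_distrib power_add split: prod.split, simp add: mult_ac)

theorem theorem8p4:
  fixes q :: nat
  assumes "q \<ge> 2"
  shows "(\<lambda>m. let n = Suc m in real ((2 * n) choose n) / (4 ^ n * real n ^ (q - 1))) sums
     ((-1) ^ q * (\<Sum>(k1, k2, k3, k4) \<in> {(k1, k2, k3, k4). k1 + k2 + k3 + k4 = q - 1}.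
        G k1 k2 k3 k4))"
proof -
  define p where "p = q - 2"
  have q: "q = Suc (Suc p)"
    using assms by (simp add: p_def)
  have "summable (\<lambda>n. cbin (Suc n) / real (Suc n) ^ Suc p)"
  proof (rule summable_comparison_test'[OF summable_cbin_div])
    fix n
    have "cbin (Suc n) / real (Suc n) ^ Suc p \<le> cbin (Suc n) / real (Suc n) ^ 1"
      using cbin_pos[of "Suc n"] by (intro divide_left_mono power_increasing) auto
    then show "norm (cbin (Suc n) / real (Suc n) ^ Suc p) \<le> cbin (Suc n) / real (Suc n)"
      using cbin_pos[of "Suc n"] by simp
  qed
  \<comment> \<open>The coefficient of index p+1 carries the sign (-1)^p, and q = p+2 has the same
    parity as p.\<close>
  then have "(\<lambda>n. cbin (Suc n) / real (Suc n) ^ Suc p) sums ((-1) ^ q * cbin_fps $ Suc p)"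
    by (simp add: sums_iff cbin_fps_def q flip: mult.assoc power_add)
  then show ?thesis
    by (simp only: cbin_fps_eq_G_fps G_fps_nth) (simp add: q cbin_def Let_def)
qed

end
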